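(* Let $g:\mathbb{N}\to\mathbb{Z}$ be an arithmetic function with $g(1)=1$. Define polynomials $P_n^g(x)$ by $P_0^g(x)=1$ and, for $n\ge 1$, $$P_n^g(x)=\frac{x}{n}\sum_{k=1}^{n} g(k)\,P_{n-k}^g(x),$$ and let $\mathcal{Z}^g=\bigcup_{n\ge 1}\{z\in\mathbb{C}: P_n^g(z)=0\}$ be the set of all zeros of all $P_n^g$ with $n\ge1$. Let $m\ge 3$, let $\zeta_m$ be a primitive $m$th root of unity, let $K=\mathbb{Q}(\zeta_m)$ be the $m$th cyclotomic field and $\mathcal{O}_K$ its ring of integers. Then: (i) If there exists a prime $p\neq 2$ with $p\mid m$, then $\{\zeta_m+2\beta:\beta\in\mathcal{O}_K\}\cap\mathcal{Z}^g=\emptyset$. (ii) If $m$ is not of the form $2^a3^\ell$ with $a\in\{0,1\}$ and $\ell\in\mathbb{N}_0$, and $g(3)\equiv 0$ or $g(3)\equiv 1\pmod 3$, then $\{\zeta_m+3\beta:\beta\in\mathcal{O}_K\}\cap\mathcal{Z}^g=\emptyset$.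
   Context: An arithmetic function $g:\mathbb{N}\to\mathbb{Z}$ is called normalized if $g(1)=1$. Note that $n!\,P_n^g(x)$ is a monic polynomial with integer coefficients, so $\mathcal{Z}^g$ consists of algebraic integers. *)

theory Defs
  imports
    "HOL-Algebra.Generated_Fields"
    "HOL-Algebra.Algebraic_Closure_Type"
    "HOL-Number_Theory.Cong"
    Complex_Main
begin

text \<open>
  An arithmetic function on the positive integers is a function \<open>g :: nat \<Rightarrow> int\<close>;
  the value \<open>g 0\<close> is never used.
\<close>

fun P_poly :: "(nat \<Rightarrow> int) \<Rightarrow> nat \<Rightarrow> complex poly" where
  "P_poly g 0 = 1"
| "P_poly g (Suc n) =
     smult (1 / of_nat (Suc n)) [:0, 1:] *
       (\<Sum>k=1..Suc n. of_int (g k) * P_poly g (Suc n - k))"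

definition zero_set :: "(nat \<Rightarrow> int) \<Rightarrow> complex set" where
  "zero_set g = (\<Union>n\<in>{1..}. {z. poly (P_poly g n) z = 0})"

definition primitive_root_of_unity :: "nat \<Rightarrow> complex \<Rightarrow> bool" where
  "primitive_root_of_unity m z \<longleftrightarrow> m > 0 \<and> z ^ m = 1 \<and> (\<forall>k. 0 < k \<and> k < m \<longrightarrow> z ^ k \<noteq> 1)"

text \<open>
  The subfield of the complex numbers generated by \<open>z\<close>; in characteristic 0 it contains
  the rationals, so it is \<open>\<rat>(z)\<close>.
\<close>

definition rat_adjoin :: "complex \<Rightarrow> complex set" where
  "rat_adjoin z = generate_field ring_of_type_algebra {z}"

definition ring_of_integers :: "complex set \<Rightarrow> complex set" where
  "ring_of_integers K = {x \<in> K. algebraic_int x}"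

end

theory Submission
  imports Defs "Jordan_Normal_Form.Char_Poly"
begin

text \<open>
  For an algebraic integer \<open>z\<close> put \<open>A\<^sub>n = n! P\<^sub>n(z)\<close>. Modulo the ideal generated by a prime \<open>p\<close> in the ring
  of all algebraic integers, the recurrence gives \<open>A\<^bsub>pj+r\<^esub> \<equiv> A\<^bsub>pj\<^esub> A\<^sub>r\<close> for \<open>r \<le> p\<close>. Hence every \<open>A\<^sub>n\<close> is
  a unit modulo \<open>p\<close>, and in particular nonzero, as soon as \<open>A\<^sub>1, \<dots>, A\<^sub>p\<close> are. For \<open>p = 2, 3\<close> these
  factor modulo \<open>p\<close> into terms \<open>z - c\<close> with \<open>c\<close> an integer, so it remains to see that \<open>\<zeta> - c\<close> is a
  unit modulo \<open>p\<close> for \<open>c \<in> {0, 1}\<close> or \<open>c \<in> {0, 1, -1}\<close>. This holds because \<open>1 - u\<close> divides \<open>n\<close> whenever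
  \<open>u \<noteq> 1\<close> and \<open>u\<^sup>n = 1\<close>; apply it to powers of \<open>\<plusminus>\<zeta>\<close> of order prime to \<open>p\<close>.
\<close>

section \<open>Algebraic integers form a ring\<close>

text \<open>The determinant trick: the integer matrix \<open>A\<close> of multiplication by
  \<open>x\<close> on the \<open>f i\<close> has the vector of the \<open>f i\<close> as an
  eigenvector for \<open>x\<close>, nonzero thanks to \<open>f i\<^sub>0\<close>. So
  \<open>x\<close> is a root of \<open>char_poly A\<close>, which is monic with integer
  coefficients.\<close>

lemma algebraic_int_if_stable_module:
  fixes x :: "'a :: field_char_0" and f :: "'i \<Rightarrow> 'a"
  assumes "finite I" and "i\<^sub>0 \<in> I" and "f i\<^sub>0 \<noteq> 0"
    and stable: "\<And>i. i \<in> I \<Longrightarrow> \<exists>a :: 'i \<Rightarrow> int. x * f i = (\<Sum>j\<in>I. of_int (a j) * f j)"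
  shows "algebraic_int x"
proof -
  from stable obtain a :: "'i \<Rightarrow> 'i \<Rightarrow> int"
    where a: "\<And>i. i \<in> I \<Longrightarrow> x * f i = (\<Sum>j\<in>I. of_int (a i j) * f j)"
    by metis
  define n where "n = card I"
  obtain h where h: "bij_betw h {0..<n} I"
    using ex_bij_betw_nat_finite[OF \<open>finite I\<close>] n_def by blast
  define A where "A = mat n n (\<lambda>(i, j). a (h i) (h j))"
  define v where "v = vec n (\<lambda>i. f (h i))"
  have A: "A \<in> carrier_mat n n" by (simp add: A_def)
  have "eigenvector (map_mat of_int A) v x"
    unfolding eigenvector_def
  proof (intro conjI)
    show "v \<in> carrier_vec (dim_row (map_mat of_int A))" by (simp add: v_def A_def)
    obtain k where "k < n" "h k = i\<^sub>0"
      using h \<open>i\<^sub>0 \<in> I\<close> unfolding bij_betw_def by (metis atLeastLessThan_iff imageE)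
    hence "v $ k \<noteq> 0" using \<open>f i\<^sub>0 \<noteq> 0\<close> by (simp add: v_def)
    thus "v \<noteq> 0\<^sub>v (dim_row (map_mat of_int A))"
      using \<open>k < n\<close> by (auto simp: A_def)
    show "map_mat of_int A *\<^sub>v v = x \<cdot>\<^sub>v v"
    proof (rule eq_vecI)
      fix i assume "i < dim_vec (x \<cdot>\<^sub>v v)"
      hence i: "i < n" by (simp add: v_def)
      hence "h i \<in> I" using h by (auto simp: bij_betw_def)
      have "(map_mat of_int A *\<^sub>v v) $ i = (\<Sum>j\<in>{0..<n}. of_int (a (h i) (h j)) * f (h j))"
        using i by (simp add: A_def v_def scalar_prod_def)
      also have "\<dots> = (\<Sum>j\<in>I. of_int (a (h i) j) * f j)"
        by (rule sum.reindex_bij_betw[OF h])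
      finally show "(map_mat of_int A *\<^sub>v v) $ i = (x \<cdot>\<^sub>v v) $ i"
        using i a[OF \<open>h i \<in> I\<close>] by (simp add: v_def)
    qed (simp add: A_def v_def)
  qed
  hence "poly (char_poly (map_mat of_int A)) x = 0"
    using eigenvalue_root_char_poly[of "map_mat of_int A" n x] A by (auto simp: eigenvalue_def)
  hence "poly (map_poly of_int (char_poly A)) x = 0"
    by (simp add: of_int_hom.char_poly_hom[OF A])
  moreover have "lead_coeff (char_poly A) = 1"
    using degree_monic_char_poly[OF A] by simp
  ultimately show ?thesis
    unfolding algebraic_int_altdef_ipoly by blast
qed

text \<open>If \<open>x\<close> and \<open>y\<close> satisfy monic equations of degrees
  \<open>n\<close> and \<open>m\<close>, the products \<open>x ^ i * y ^ j\<close> with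
  \<open>i < n\<close>, \<open>j < m\<close> span a finitely generated module over the integers that
  is stable under multiplication by \<open>x\<close> and by \<open>y\<close>, hence by
  \<open>x + y\<close> and \<open>x * y\<close>.\<close>

lemma
  fixes x y :: "'a :: field_char_0"
  assumes "algebraic_int x" and "algebraic_int y"
  shows algebraic_int_add: "algebraic_int (x + y)"
    and algebraic_int_mult: "algebraic_int (x * y)"
proof -
  \<comment> \<open>A monic equation solved for its top power. Its degree is positive because the
    constant 1 has no root; this later puts the pair \<open>(0, 0)\<close>, with
    \<open>f (0, 0) = 1\<close>, into \<open>I\<close>.\<close>
  have top: "\<exists>n>0. \<exists>c :: nat \<Rightarrow> int. z ^ n = (\<Sum>i<n. of_int (c i) * z ^ i)"
    if z: "algebraic_int z" for z :: 'a
  proof -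
    obtain p where p: "poly (map_poly of_int p) z = 0" "lead_coeff p = 1"
      using z by (auto simp: algebraic_int_altdef_ipoly)
    let ?n = "degree p"
    have "?n > 0"
      using p by (intro Nat.gr0I) (auto elim!: degree_eq_zeroE)
    have "0 = (\<Sum>i\<le>?n. of_int (coeff p i) * z ^ i)"
      using p by (simp add: poly_altdef coeff_map_poly)
    also have "\<dots> = (\<Sum>i<?n. of_int (coeff p i) * z ^ i) + z ^ ?n"
      using p(2) by (simp add: lessThan_Suc_atMost[symmetric])
    finally have "z ^ ?n = (\<Sum>i<?n. of_int (- coeff p i) * z ^ i)"
      by (simp add: sum_negf eq_neg_iff_add_eq_0 add.commute)
    with \<open>?n > 0\<close> show ?thesis by (intro exI[of _ ?n] conjI exI[of _ "\<lambda>i. - coeff p i"]) auto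
  qed
  obtain n c where n: "n > 0" and c: "x ^ n = (\<Sum>i<n. of_int (c i) * x ^ i)"
    using top[OF assms(1)] by blast
  obtain m d where m: "m > 0" and d: "y ^ m = (\<Sum>i<m. of_int (d i) * y ^ i)"
    using top[OF assms(2)] by blast
  define I where "I = {..<n} \<times> {..<m}"
  define f where "f = (\<lambda>(i, j). x ^ i * y ^ j)"
  define S where "S = {s. \<exists>a :: nat \<times> nat \<Rightarrow> int. s = (\<Sum>j\<in>I. of_int (a j) * f j)}"
  have fin: "finite I" by (simp add: I_def)
  have gen: "f i \<in> S" if "i \<in> I" for i
    unfolding S_def using fin that
    by (auto intro!: exI[of _ "\<lambda>j. if j = i then 1 else 0"]
        simp: if_distrib[of of_int] if_distrib[of "\<lambda>t. t * _"] sum.delta cong: if_cong)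
  have zero: "0 \<in> S" unfolding S_def by (auto intro!: exI[of _ "\<lambda>_. 0"])
  have add: "s + t \<in> S" if "s \<in> S" "t \<in> S" for s t
  proof -
    from that obtain a b :: "nat \<times> nat \<Rightarrow> int"
      where "s = (\<Sum>j\<in>I. of_int (a j) * f j)" "t = (\<Sum>j\<in>I. of_int (b j) * f j)"
      unfolding S_def by blast
    hence "s + t = (\<Sum>j\<in>I. of_int (a j + b j) * f j)"
      by (simp add: sum.distrib distrib_right)
    thus ?thesis unfolding S_def by (intro CollectI exI[of _ "\<lambda>j. a j + b j"])
  qed
  have scale: "of_int k * s \<in> S" if "s \<in> S" for s k
  proof -
    from that obtain a :: "nat \<times> nat \<Rightarrow> int" where "s = (\<Sum>j\<in>I. of_int (a j) * f j)"
      unfolding S_def by blast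
    hence "of_int k * s = (\<Sum>j\<in>I. of_int (k * a j) * f j)"
      by (simp add: sum_distrib_left mult.assoc)
    thus ?thesis unfolding S_def by (intro CollectI exI[of _ "\<lambda>j. k * a j"])
  qed
  have sums: "(\<Sum>j\<in>J. of_int (a j) * t j) \<in> S" if "\<And>j. j \<in> J \<Longrightarrow> t j \<in> S"
    for J :: "'b set" and a t
    using that by (induction J rule: infinite_finite_induct) (auto intro: zero add scale)
  have x: "x * f i \<in> S" if iI: "i \<in> I" for i
  proof -
    obtain k l where i: "i = (k, l)" "k < n" "l < m" using iI by (auto simp: I_def)
    show ?thesis
    proof (cases "Suc k < n")
      case True
      thus ?thesis using gen[of "(Suc k, l)"] i by (simp add: I_def f_def mult_ac)
    next
      \<comment> \<open>Here the exponent would leave the range, and the monic equation rewrites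
        \<open>x ^ n\<close> in lower powers.\<close>
      case False
      hence "n = Suc k" using i by simp
      hence "x * f i = x ^ n * y ^ l" by (simp add: i f_def mult_ac)
      also have "\<dots> = (\<Sum>j<n. of_int (c j) * f (j, l))"
        by (simp add: c sum_distrib_left f_def mult_ac)
      also have "\<dots> \<in> S" using i by (intro sums gen) (auto simp: I_def)
      finally show ?thesis .
    qed
  qed
  have y: "y * f i \<in> S" if iI: "i \<in> I" for i
  proof -
    obtain k l where i: "i = (k, l)" "k < n" "l < m" using iI by (auto simp: I_def)
    show ?thesis
    proof (cases "Suc l < m")
      case True
      thus ?thesis using gen[of "(k, Suc l)"] i by (simp add: I_def f_def mult_ac)
    next
      case False
      hence "m = Suc l" using i by simp
      hence "y * f i = y ^ m * x ^ k" by (simp add: i f_def mult_ac)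
      also have "\<dots> = (\<Sum>j<m. of_int (d j) * f (k, j))"
        by (simp add: d sum_distrib_left f_def mult_ac)
      also have "\<dots> \<in> S" using i by (intro sums gen) (auto simp: I_def)
      finally show ?thesis .
    qed
  qed
  have xy: "x * y * f i \<in> S" if "i \<in> I" for i
  proof -
    obtain a :: "nat \<times> nat \<Rightarrow> int" where a: "y * f i = (\<Sum>j\<in>I. of_int (a j) * f j)"
      using y[OF \<open>i \<in> I\<close>] unfolding S_def by blast
    have "x * y * f i = (\<Sum>j\<in>I. of_int (a j) * (x * f j))"
      by (simp add: mult.assoc a sum_distrib_left mult.left_commute)
    also have "\<dots> \<in> S" by (intro sums x)
    finally show ?thesis .
  qed
  have one: "(0, 0) \<in> I" "f (0, 0) \<noteq> 0" using n m by (auto simp: I_def f_def)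
  show "algebraic_int (x + y)"
  proof (rule algebraic_int_if_stable_module[where f = f, OF fin one])
    fix i assume "i \<in> I"
    hence "(x + y) * f i \<in> S" by (simp add: distrib_right add x y)
    thus "\<exists>a :: nat \<times> nat \<Rightarrow> int. (x + y) * f i = (\<Sum>j\<in>I. of_int (a j) * f j)"
      by (simp add: S_def)
  qed
  show "algebraic_int (x * y)"
  proof (rule algebraic_int_if_stable_module[where f = f, OF fin one])
    fix i assume "i \<in> I"
    thus "\<exists>a :: nat \<times> nat \<Rightarrow> int. x * y * f i = (\<Sum>j\<in>I. of_int (a j) * f j)"
      using xy by (simp add: S_def)
  qed
qed

lemma algebraic_int_diff:
  fixes x y :: "'a :: field_char_0"
  shows "algebraic_int x \<Longrightarrow> algebraic_int y \<Longrightarrow> algebraic_int (x - y)"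
  using algebraic_int_add[of x "- y"] by simp

lemma algebraic_int_sum:
  fixes f :: "'i \<Rightarrow> 'a :: field_char_0"
  shows "(\<And>i. i \<in> I \<Longrightarrow> algebraic_int (f i)) \<Longrightarrow> algebraic_int (\<Sum>i\<in>I. f i)"
  by (induction I rule: infinite_finite_induct) (auto intro: algebraic_int_add)

lemma algebraic_int_power:
  fixes x :: "'a :: field_char_0"
  shows "algebraic_int x \<Longrightarrow> algebraic_int (x ^ n)"
  by (induction n) (auto intro: algebraic_int_mult)

lemmas algebraic_int_intros =
  algebraic_int_add algebraic_int_mult algebraic_int_diff algebraic_int_sum algebraic_int_power

section \<open>Congruences and units modulo \<open>p\<close> among algebraic integers\<close>

text \<open>The quotient \<open>w\<close> may be any complex algebraic integer, so no number field
  has to be tracked. Only the difference of \<open>x\<close> and \<open>y\<close> is constrained,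
  not the two numbers themselves.\<close>

definition alg_cong :: "nat \<Rightarrow> complex \<Rightarrow> complex \<Rightarrow> bool" where
  "alg_cong p x y \<longleftrightarrow> (\<exists>w. algebraic_int w \<and> x = y + of_nat p * w)"

lemma alg_congI: "algebraic_int w \<Longrightarrow> x = y + of_nat p * w \<Longrightarrow> alg_cong p x y"
  by (auto simp: alg_cong_def)

lemma alg_cong_refl [simp]: "alg_cong p x x"
  by (rule alg_congI[of 0]) auto

lemma alg_cong_trans [trans]: "alg_cong p x y \<Longrightarrow> alg_cong p y z \<Longrightarrow> alg_cong p x z"
  unfolding alg_cong_def by (metis add.assoc algebraic_int_add distrib_left)

lemma alg_cong_add:
  assumes "alg_cong p x y" and "alg_cong p x' y'"
  shows "alg_cong p (x + x') (y + y')"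
proof -
  obtain w w' where "algebraic_int w" "x = y + of_nat p * w" "algebraic_int w'" "x' = y' + of_nat p * w'"
    using assms by (auto simp: alg_cong_def)
  thus ?thesis
    by (intro alg_congI[of "w + w'"]) (auto simp: algebra_simps intro: algebraic_int_intros)
qed

text \<open>From \<open>x * x' - y * y' = (x - y) * x' + y * (x' - y')\<close>; the integrality of
  \<open>y\<close> and \<open>x'\<close> makes the new quotient integral.\<close>

lemma alg_cong_mult:
  assumes "alg_cong p x y" and "alg_cong p x' y'" and "algebraic_int y" and "algebraic_int x'"
  shows "alg_cong p (x * x') (y * y')"
proof -
  obtain w w' where "algebraic_int w" "x = y + of_nat p * w" "algebraic_int w'" "x' = y' + of_nat p * w'"
    using assms by (auto simp: alg_cong_def)
  thus ?thesis using assms(3,4)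
    by (intro alg_congI[of "w * x' + y * w'"] algebraic_int_intros) (auto simp: algebra_simps)
qed

lemma alg_cong_sum:
  assumes "\<And>i. i \<in> I \<Longrightarrow> alg_cong p (f i) (h i)"
  shows "alg_cong p (\<Sum>i\<in>I. f i) (\<Sum>i\<in>I. h i)"
  using assms by (induction I rule: infinite_finite_induct) (auto intro: alg_cong_add)

lemma alg_cong_of_int:
  assumes "[a = b] (mod int p)"
  shows "alg_cong p (of_int a) (of_int b)"
proof -
  obtain k where "a = b + int p * k"
    using assms by (metis cong_iff_lin cong_sym)
  thus ?thesis by (intro alg_congI[of "of_int k"]) auto
qed

definition unit_mod :: "nat \<Rightarrow> complex \<Rightarrow> bool" where
  "unit_mod p x \<longleftrightarrow> algebraic_int x \<and> (\<exists>y. algebraic_int y \<and> alg_cong p (x * y) 1)"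

lemma unit_mod_1 [simp]: "unit_mod p 1"
  unfolding unit_mod_def by (auto intro: exI[of _ 1])

lemma unit_mod_mult:
  assumes "unit_mod p x" and "unit_mod p y"
  shows "unit_mod p (x * y)"
proof -
  obtain x' y' where *: "algebraic_int x" "algebraic_int x'" "alg_cong p (x * x') 1"
      "algebraic_int y" "algebraic_int y'" "alg_cong p (y * y') 1"
    using assms by (auto simp: unit_mod_def)
  hence "alg_cong p (x * x' * (y * y')) (1 * 1)"
    by (intro alg_cong_mult algebraic_int_intros) auto
  with * show ?thesis unfolding unit_mod_def
    by (intro conjI exI[of _ "x' * y'"]) (auto simp: mult_ac intro: algebraic_int_intros)
qed

text \<open>If \<open>c\<close> inverts \<open>x * y\<close>, then \<open>y * c\<close> inverts
  \<open>x\<close>.\<close>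

lemma unit_mod_factor:
  assumes "unit_mod p (x * y)" and "algebraic_int x" and "algebraic_int y"
  shows "unit_mod p x"
  using assms unfolding unit_mod_def by (metis algebraic_int_mult mult.assoc)

lemma unit_mod_cong:
  assumes "alg_cong p x y" and "unit_mod p y"
  shows "unit_mod p x"
proof -
  obtain y' where y: "algebraic_int y" "algebraic_int y'" "alg_cong p (y * y') 1"
    using assms by (auto simp: unit_mod_def)
  obtain w where "algebraic_int w" "x = y + of_nat p * w"
    using assms by (auto simp: alg_cong_def)
  hence "algebraic_int x" using y by (auto intro: algebraic_int_intros)
  have "alg_cong p (x * y') (y * y')"
    using assms y by (intro alg_cong_mult) auto
  also note y(3)
  finally show ?thesis using y \<open>algebraic_int x\<close> unfolding unit_mod_def by blast
qed

text \<open>Otherwise \<open>-1/p\<close> would be an algebraic integer; being rational, it would be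
  an integer.\<close>

lemma not_unit_mod_0:
  assumes "p \<ge> 2"
  shows "\<not> unit_mod p 0"
proof
  assume "unit_mod p 0"
  then obtain w :: complex where w: "algebraic_int w" "1 + of_nat p * w = 0"
    by (auto simp: unit_mod_def alg_cong_def)
  hence "w = of_int (-1) / of_int (int p)" using assms by (simp add: field_simps add_eq_0_iff)
  hence "w \<in> \<rat>" by simp
  with w obtain k where "w = of_int k"
    using rational_algebraic_int_is_int by (auto elim: Ints_cases)
  with w have "of_int (1 + int p * k) = (0 :: complex)" by simp
  hence "1 + int p * k = 0" by (simp only: of_int_eq_0_iff)
  hence "int p dvd 1" by (metis add_eq_0_iff dvd_minus_iff dvd_triv_left)
  thus False using assms by simp
qed

lemma unit_mod_of_int:
  assumes "coprime a (int p)"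
  shows "unit_mod p (of_int a)"
proof -
  obtain b where "[a * b = 1] (mod int p)"
    using assms cong_solve_coprime_int by blast
  hence "alg_cong p (of_int a * of_int b) 1"
    using alg_cong_of_int[of "a * b" 1 p] by simp
  thus ?thesis unfolding unit_mod_def by (auto intro: exI[of _ "of_int b"])
qed

section \<open>Units modulo \<open>p\<close> from roots of unity\<close>

lemma algebraic_int_root_of_unity:
  fixes u :: "'a :: field_char_0"
  assumes "u ^ n = 1" and "n > 0"
  shows "algebraic_int u"
proof (rule algebraic_int_root)
  show "poly (monom 1 n) u = 1" using assms by (simp add: poly_monom)
qed (use assms in \<open>auto simp: degree_monom_eq\<close>)

text \<open>The powers \<open>u ^ i\<close> with \<open>i < n\<close> sum to 0, so \<open>n\<close>
  is the sum of the \<open>1 - u ^ i\<close>, each a multiple of \<open>1 - u\<close>. Thus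
  \<open>1 - u\<close> divides \<open>n\<close>, which is invertible modulo
  \<open>p\<close>.\<close>

lemma unit_mod_one_minus_root_of_unity:
  assumes "u ^ n = 1" and "u \<noteq> 1" and "n > 0" and "coprime n p"
  shows "unit_mod p (1 - u)"
proof -
  have u: "algebraic_int u" using assms by (intro algebraic_int_root_of_unity)
  have "(1 - u) * (\<Sum>i<n. u ^ i) = 0"
    using assms(1) by (simp add: one_diff_power_eq[symmetric])
  hence "(\<Sum>i<n. u ^ i) = 0" using assms(2) by simp
  hence "of_nat n = (\<Sum>i<n. 1 - u ^ i)" by (simp add: sum_subtractf)
  also have "\<dots> = (1 - u) * (\<Sum>i<n. \<Sum>j<i. u ^ j)"
    by (simp add: one_diff_power_eq sum_distrib_left)
  finally have "unit_mod p ((1 - u) * (\<Sum>i<n. \<Sum>j<i. u ^ j))"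
    using unit_mod_of_int[of "int n" p] assms(4) by simp
  thus ?thesis by (rule unit_mod_factor) (auto intro!: algebraic_int_intros u)
qed

text \<open>\<open>1 - u\<close> divides \<open>1 - u ^ k\<close>. This leads back from a power of
  order prime to \<open>p\<close> to the root of unity itself.\<close>

lemma unit_mod_one_minus_power:
  assumes "unit_mod p (1 - u ^ k)" and "algebraic_int u"
  shows "unit_mod p (1 - u)"
proof (rule unit_mod_factor)
  show "unit_mod p ((1 - u) * (\<Sum>i<k. u ^ i))"
    using assms(1) by (simp add: one_diff_power_eq)
qed (use assms in \<open>auto intro!: algebraic_int_intros\<close>)

lemma unit_mod_root_of_unity:
  assumes "u ^ n = 1" and "n > 0"
  shows "unit_mod p u"
proof (rule unit_mod_factor)
  show "unit_mod p (u * u ^ (n - 1))" using assms by (simp flip: power_Suc)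
qed (use algebraic_int_root_of_unity[OF assms] in \<open>auto intro!: algebraic_int_intros\<close>)

section \<open>The scaled values \<open>n! P_n(z)\<close> and their recurrence modulo
  \<open>p\<close>\<close>

definition P_int :: "(nat \<Rightarrow> int) \<Rightarrow> complex \<Rightarrow> nat \<Rightarrow> complex" where
  "P_int g z n = fact n * poly (P_poly g n) z"

lemma P_int_0 [simp]: "P_int g z 0 = 1"
  by (simp add: P_int_def)

text \<open>Scaling by \<open>(n+1)!\<close> cancels the denominator \<open>n+1\<close>. With the
  index shifted to start at 0, the quotient \<open>n!/(n-k)!\<close> becomes
  \<open>fact k * (n choose k)\<close>, an integer that also makes sense, and vanishes, for
  \<open>k > n\<close>.\<close>

lemma P_int_Suc:
  "P_int g z (Suc n) =
     z * (\<Sum>k\<le>n. of_int (g (Suc k) * int (fact k * (n choose k))) * P_int g z (n - k))"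
proof -
  have "P_int g z (Suc n) = fact n * (z * (\<Sum>k=1..Suc n. of_int (g k) * poly (P_poly g (Suc n - k)) z))"
    by (simp add: P_int_def poly_sum del: sum.cl_ivl_Suc of_nat_Suc)
  also have "(\<Sum>k=1..Suc n. of_int (g k) * poly (P_poly g (Suc n - k)) z) =
      (\<Sum>k\<le>n. of_int (g (Suc k)) * poly (P_poly g (n - k)) z)"
    by (rule sum.reindex_bij_witness[of _ Suc "\<lambda>k. k - 1"]) auto
  also have "fact n * (z * \<dots>) = z * (\<Sum>k\<le>n. fact n * (of_int (g (Suc k)) * poly (P_poly g (n - k)) z))"
    by (simp add: sum_distrib_left mult_ac)
  also have "(\<Sum>k\<le>n. fact n * (of_int (g (Suc k)) * poly (P_poly g (n - k)) z)) =
      (\<Sum>k\<le>n. of_int (g (Suc k) * int (fact k * (n choose k))) * P_int g z (n - k))"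
  proof (rule sum.cong)
    fix k assume "k \<in> {..n}"
    hence "fact k * fact (n - k) * (n choose k) = (fact n :: nat)"
      by (intro binomial_fact_lemma) simp
    hence "(fact n :: complex) = fact k * fact (n - k) * of_nat (n choose k)"
      by (metis of_nat_fact of_nat_mult)
    thus "fact n * (of_int (g (Suc k)) * poly (P_poly g (n - k)) z) =
        of_int (g (Suc k) * int (fact k * (n choose k))) * P_int g z (n - k)"
      by (simp add: P_int_def mult_ac)
  qed simp
  finally show ?thesis .
qed

lemma algebraic_int_P_int:
  assumes "algebraic_int z"
  shows "algebraic_int (P_int g z n)"
proof (induction n rule: less_induct)
  case (less n)
  thus ?case using assms
    by (cases n) (auto simp: P_int_Suc intro!: algebraic_int_intros simp del: of_int_mult)
qed

text \<open>In product form the coefficients of the recurrence visibly depend only on \<open>n mod p\<close>.\<close>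

lemma fact_mult_binomial_eq_prod: "int (fact k * (n choose k)) = (\<Prod>i<k. int n - int i)"
proof -
  have "real_of_int (int (fact k * (n choose k))) = fact k * (real n gchoose k)"
    by (simp add: binomial_gbinomial)
  also have "\<dots> = (\<Prod>i<k. real n - real i)"
    by (simp add: gbinomial_mult_fact atLeast0LessThan)
  also have "\<dots> = real_of_int (\<Prod>i<k. int n - int i)" by simp
  finally show ?thesis by (simp only: of_int_eq_iff)
qed

text \<open>In the recurrence for index \<open>p * j + s + 1\<close>, the coefficients agree modulo
  \<open>p\<close> with those for \<open>s + 1\<close> and vanish beyond \<open>k = s\<close>. By
  induction the remaining terms share the factor \<open>P_int g z (p * j)\<close>, and the other
  factors sum up to the recurrence for \<open>s + 1\<close>.\<close>

lemma P_int_cong: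
  assumes z: "algebraic_int z" and "p > 0" and "r \<le> p"
  shows "alg_cong p (P_int g z (p * j + r)) (P_int g z (p * j) * P_int g z r)"
  using \<open>r \<le> p\<close>
proof (induction r rule: less_induct)
  case (less r)
  show ?case
  proof (cases r)
    case 0
    thus ?thesis by simp
  next
    case (Suc s)
    let ?A = "P_int g z" and ?n = "p * j + s"
    let ?c = "\<lambda>n k. g (Suc k) * int (fact k * (n choose k))"
    note alg = algebraic_int_P_int[OF z]
    have summand: "alg_cong p (of_int (?c ?n k) * ?A (?n - k))
        (if k \<le> s then of_int (?c s k) * (?A (p * j) * ?A (s - k)) else 0)" for k
    proof -
      \<comment> \<open>Factor by factor, as \<open>?n\<close> and \<open>s\<close> differ by
        \<open>p * j\<close>.\<close>
      have "[(\<Prod>i<k. int ?n - int i) = (\<Prod>i<k. int s - int i)] (mod int p)"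
        by (intro cong_prod) (auto simp: cong_def mod_simps simp flip: add_diff_eq)
      hence "[?c ?n k = ?c s k] (mod int p)"
        unfolding fact_mult_binomial_eq_prod by (intro cong_mult) auto
      hence c: "alg_cong p (of_int (?c ?n k)) (of_int (?c s k))"
        by (rule alg_cong_of_int)
      show ?thesis
      proof (cases "k \<le> s")
        case True
        have "alg_cong p (?A (p * j + (s - k))) (?A (p * j) * ?A (s - k))"
          using less Suc by auto
        with True c show ?thesis
          by (auto intro!: alg_cong_mult alg simp del: of_int_mult)
      next
        case False
        have "alg_cong p (of_int (?c ?n k) * ?A (?n - k)) (of_int (?c s k) * ?A (?n - k))"
          using c by (intro alg_cong_mult alg) (auto simp del: of_int_mult)
        with False show ?thesis by (simp add: binomial_eq_0)
      qed
    qed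
    let ?S = "\<Sum>k\<le>?n. of_int (?c ?n k) * ?A (?n - k)"
    let ?T = "\<Sum>k\<le>?n. if k \<le> s then of_int (?c s k) * (?A (p * j) * ?A (s - k)) else 0"
    have cong: "alg_cong p (z * ?S) (z * ?T)"
      by (rule alg_cong_mult[OF alg_cong_refl alg_cong_sum[OF summand] z])
        (intro algebraic_int_intros alg algebraic_int_of_int)
    have lhs: "?A (p * j + r) = z * ?S"
      using Suc by (simp add: P_int_Suc)
    have "?T = (\<Sum>k\<le>s. of_int (?c s k) * (?A (p * j) * ?A (s - k)))"
      by (rule sum.mono_neutral_cong_right) simp_all
    hence rhs: "z * ?T = ?A (p * j) * ?A r"
      unfolding Suc P_int_Suc[of g z s] by (simp only: sum_distrib_left mult_ac)
    show ?thesis using cong unfolding lhs rhs .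
  qed
qed

text \<open>The case \<open>r = p\<close> of the congruence carries an induction from
  \<open>p * j\<close> to \<open>p * (j + 1)\<close>; the remainder \<open>n mod p\<close> is then
  split off once.\<close>

lemma unit_mod_P_int:
  assumes z: "algebraic_int z" and "p > 0"
    and "\<And>r. 1 \<le> r \<Longrightarrow> r \<le> p \<Longrightarrow> unit_mod p (P_int g z r)"
  shows "unit_mod p (P_int g z n)"
proof -
  have r: "unit_mod p (P_int g z r)" if "r \<le> p" for r
    using assms(3)[of r] that by (cases "r = 0") auto
  have "unit_mod p (P_int g z (p * j))" for j
  proof (induction j)
    case (Suc j)
    have "unit_mod p (P_int g z (p * j + p))"
      using unit_mod_cong[OF P_int_cong[OF z \<open>p > 0\<close> le_refl]] unit_mod_mult[OF Suc r] by simp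
    thus ?case by (simp add: add.commute)
  qed simp
  hence "unit_mod p (P_int g z (p * (n div p) + n mod p))"
    using \<open>p > 0\<close> by (intro unit_mod_cong[OF P_int_cong[OF z]] unit_mod_mult r[of "n mod p"]) auto
  thus ?thesis by simp
qed

lemma not_in_zero_set:
  assumes "algebraic_int z" and "p \<ge> 2"
    and "\<And>r. 1 \<le> r \<Longrightarrow> r \<le> p \<Longrightarrow> unit_mod p (P_int g z r)"
  shows "z \<notin> zero_set g"
proof
  assume "z \<in> zero_set g"
  then obtain n where "P_int g z n = 0" by (auto simp: zero_set_def P_int_def)
  thus False using unit_mod_P_int[OF assms(1), of p g n] assms not_unit_mod_0[of p] by simp
qed

text \<open>The third value is \<open>z * (z^2 + 3 g(2) z + 2 g(3))\<close>, arranged with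
  \<open>2 g(3) = 3 g(3) - g(3)\<close> so that the multiple of 3 stands apart.\<close>

lemma
  assumes "g 1 = 1"
  shows P_int_1: "P_int g z 1 = z"
    and P_int_2: "P_int g z 2 = z * (z + of_int (g 2))"
    and P_int_3: "P_int g z 3 = z * (z ^ 2 - of_int (g 3)) + 3 * (z * (of_int (g 2) * z + of_int (g 3)))"
proof -
  show 1: "P_int g z 1 = z" using assms P_int_Suc[of g z 0] by simp
  show 2: "P_int g z 2 = z * (z + of_int (g 2))"
    using assms 1 P_int_Suc[of g z 1] by (simp add: numeral_2_eq_2)
  show "P_int g z 3 = z * (z ^ 2 - of_int (g 3)) + 3 * (z * (of_int (g 2) * z + of_int (g 3)))"
    using assms 1 2 P_int_Suc[of g z 2]
    by (simp add: numeral_2_eq_2 numeral_3_eq_3 algebra_simps power2_eq_square)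
qed

section \<open>Nonvanishing at numbers congruent to \<zeta> modulo 2 or 3\<close>

lemma unit_mod_shift:
  assumes "alg_cong p z w" and "[a = b] (mod int p)" and "unit_mod p (w + of_int b)"
  shows "unit_mod p (z + of_int a)"
  using unit_mod_cong[OF alg_cong_add[OF assms(1) alg_cong_of_int[OF assms(2)]] assms(3)] .

lemma unit_mod_minus:
  assumes "unit_mod p x"
  shows "unit_mod p (- x)"
  using unit_mod_mult[OF assms unit_mod_of_int[of "- 1" p]] by simp

text \<open>Raising to the full power of \<open>p\<close> in \<open>m\<close> removes the
  \<open>p\<close>-part of the order, so \<open>\<zeta> ^ p ^ k\<close> has exact order
  \<open>n\<close>, the part of \<open>m\<close> prime to \<open>p\<close>.\<close>

lemma primitive_root_of_unity_coprime_part: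
  assumes \<zeta>: "primitive_root_of_unity m \<zeta>" and p: "prime p"
  obtains k n where "m = p ^ k * n" and "n > 0" and "coprime n p" and "(\<zeta> ^ p ^ k) ^ n = 1"
    and "\<And>j. 0 < j \<Longrightarrow> j < n \<Longrightarrow> (\<zeta> ^ p ^ k) ^ j \<noteq> 1"
proof -
  have m: "m > 0" "\<zeta> ^ m = 1" "\<And>j. 0 < j \<Longrightarrow> j < m \<Longrightarrow> \<zeta> ^ j \<noteq> 1"
    using \<zeta> by (auto simp: primitive_root_of_unity_def)
  obtain n where n: "m = p ^ multiplicity p m * n" "\<not> p dvd n"
    using m(1) p multiplicity_decompose'[of m p] by (metis neq0_conv not_prime_unit)
  show thesis
  proof (rule that[of "multiplicity p m" n])
    show "m = p ^ multiplicity p m * n" by (fact n)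
    show "n > 0" using n by (intro Nat.gr0I) auto
    show "coprime n p" using prime_imp_coprime[OF p n(2)] by (simp add: coprime_commute)
    show "(\<zeta> ^ p ^ multiplicity p m) ^ n = 1" using m(2) n(1) by (simp flip: power_mult)
    fix j assume j: "0 < j" "j < n"
    have "p ^ multiplicity p m > 0" using p prime_gt_0_nat by simp
    hence "p ^ multiplicity p m * j > 0" "p ^ multiplicity p m * j < m"
      using j by (simp, subst n(1), simp)
    thus "(\<zeta> ^ p ^ multiplicity p m) ^ j \<noteq> 1" using m(3) by (simp flip: power_mult)
  qed
qed

lemma not_in_zero_set_2:
  assumes g: "g 1 = 1" and \<zeta>: "primitive_root_of_unity m \<zeta>" and z: "alg_cong 2 z \<zeta>"
    and q: "prime q" "q \<noteq> 2" "q dvd m"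
  shows "z \<notin> zero_set g"
proof -
  obtain k n where n: "m = 2 ^ k * n" "n > 0" "coprime n 2" "(\<zeta> ^ 2 ^ k) ^ n = 1"
    "\<And>j. 0 < j \<Longrightarrow> j < n \<Longrightarrow> (\<zeta> ^ 2 ^ k) ^ j \<noteq> 1"
    using primitive_root_of_unity_coprime_part[OF \<zeta> two_is_prime_nat] by metis
  \<comment> \<open>Otherwise \<open>m\<close> would be a power of 2, against the odd prime
    \<open>q\<close>.\<close>
  have "n \<noteq> 1"
  proof
    assume "n = 1"
    with q n(1) have "q dvd 2" by (auto dest: prime_dvd_power)
    with q show False using primes_dvd_imp_eq[OF q(1) two_is_prime_nat] by simp
  qed
  with n(2) n(5)[of 1] have "\<zeta> ^ 2 ^ k \<noteq> 1" by simp
  have "\<zeta> ^ m = 1" "m > 0" using \<zeta> by (auto simp: primitive_root_of_unity_def)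
  hence unit: "unit_mod 2 \<zeta>" by (rule unit_mod_root_of_unity)
  hence alg: "algebraic_int \<zeta>" by (simp add: unit_mod_def)
  have "unit_mod 2 (1 - \<zeta> ^ 2 ^ k)"
    using n \<open>\<zeta> ^ 2 ^ k \<noteq> 1\<close> by (intro unit_mod_one_minus_root_of_unity)
  hence "unit_mod 2 (- (1 - \<zeta>))"
    using alg by (rule unit_mod_minus[OF unit_mod_one_minus_power])
  hence unit1: "unit_mod 2 (\<zeta> + of_int (- 1))" by simp
  have unit_z: "unit_mod 2 z" using unit_mod_cong[OF z unit] .
  \<comment> \<open>The odd class is represented by -1 to match the unit \<zeta> - 1.\<close>
  have "[g 2 = 0] (mod int 2) \<or> [g 2 = - 1] (mod int 2)"
    unfolding cong_def by simp presburger
  hence "unit_mod 2 (z + of_int (g 2))"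
    using unit_mod_shift[OF z _ unit1] unit_mod_shift[OF z, of "g 2" 0] unit by auto
  hence 2: "unit_mod 2 (P_int g z 2)" using unit_z by (simp add: P_int_2[where g = g, OF g] unit_mod_mult)
  show ?thesis
  proof (rule not_in_zero_set)
    show "algebraic_int z" using unit_z by (simp add: unit_mod_def)
    fix r :: nat assume "1 \<le> r" "r \<le> 2"
    hence "r = 1 \<or> r = 2" by auto
    thus "unit_mod 2 (P_int g z r)"
      using unit_z 2 by (auto simp: P_int_1[where g = g, OF g, simplified])
  qed simp
qed

lemma not_in_zero_set_3:
  assumes g: "g 1 = 1" and \<zeta>: "primitive_root_of_unity m \<zeta>" and z: "alg_cong 3 z \<zeta>"
    and m: "\<nexists>a l :: nat. a \<in> {0, 1} \<and> m = 2 ^ a * 3 ^ l"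
    and g3: "[g 3 = 0] (mod 3) \<or> [g 3 = 1] (mod 3)"
  shows "z \<notin> zero_set g"
proof -
  have "prime (3 :: nat)" by simp
  then obtain k n where n: "m = 3 ^ k * n" "n > 0" "coprime n 3" "(\<zeta> ^ 3 ^ k) ^ n = 1"
    "\<And>j. 0 < j \<Longrightarrow> j < n \<Longrightarrow> (\<zeta> ^ 3 ^ k) ^ j \<noteq> 1"
    using primitive_root_of_unity_coprime_part[OF \<zeta>, of 3] by metis
  \<comment> \<open>The excluded shapes of \<open>m\<close> are exactly \<open>n = 1\<close> and
    \<open>n = 2\<close>, so the power \<open>u\<close> of order \<open>n\<close> differs from 1 and
    -1.\<close>
  have "n \<noteq> 1" using m n(1) by (auto dest: spec[of _ 0])
  moreover have "n \<noteq> 2" using m n(1) by (auto dest: spec[of _ 1] simp: mult.commute)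
  ultimately have "n > 2" using n(2) by simp
  define u where "u = \<zeta> ^ 3 ^ k"
  have u: "u ^ n = 1" "u \<noteq> 1" "u ^ 2 \<noteq> 1"
    using n(4) n(5)[of 1] n(5)[of 2] \<open>n > 2\<close> by (auto simp: u_def)
  have "\<zeta> ^ m = 1" "m > 0" using \<zeta> by (auto simp: primitive_root_of_unity_def)
  hence unit: "unit_mod 3 \<zeta>" by (rule unit_mod_root_of_unity)
  hence alg: "algebraic_int \<zeta>" by (simp add: unit_mod_def)
  have "unit_mod 3 (1 - \<zeta> ^ 3 ^ k)"
    using n u unfolding u_def by (intro unit_mod_one_minus_root_of_unity)
  hence "unit_mod 3 (- (1 - \<zeta>))"
    using alg by (rule unit_mod_minus[OF unit_mod_one_minus_power])
  hence unit1: "unit_mod 3 (\<zeta> + of_int (- 1))" by simp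
  \<comment> \<open>For \<zeta> + 1, the argument is repeated with \<open>- u\<close>: its order
    divides \<open>2 * n\<close>, still prime to 3, and it is a power of \<open>- \<zeta>\<close>
    because \<open>3 ^ k\<close> is odd.\<close>
  have "unit_mod 3 (1 - (- u))"
  proof (rule unit_mod_one_minus_root_of_unity)
    have "(- u) ^ (2 * n) = (u\<^sup>2) ^ n" by (simp only: power_mult power2_minus)
    also have "\<dots> = (u ^ n)\<^sup>2" by (simp flip: power_mult add: mult.commute)
    finally show "(- u) ^ (2 * n) = 1" by (simp add: u(1))
    show "- u \<noteq> 1" using u(3) by (auto simp: minus_equation_iff)
    show "coprime (2 * n) 3" using n(3) by (simp add: coprime_mult_left_iff)
  qed (use n in simp)
  also have "- u = (- \<zeta>) ^ 3 ^ k" by (simp add: u_def)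
  finally have "unit_mod 3 (1 - (- \<zeta>))" 
    using algebraic_int_minus[OF alg] by (rule unit_mod_one_minus_power)
  hence unit2: "unit_mod 3 (\<zeta> + of_int 1)" by (simp add: add.commute)
  have unit_z: "unit_mod 3 z" using unit_mod_cong[OF z unit] .
  hence alg_z: "algebraic_int z" by (simp add: unit_mod_def)
  have shift: "unit_mod 3 (z + of_int a)" for a
  proof -
    have "[a = 0] (mod int 3) \<or> [a = - 1] (mod int 3) \<or> [a = 1] (mod int 3)"
      unfolding cong_def by simp presburger
    thus ?thesis
      using unit_mod_shift[OF z _ unit1] unit_mod_shift[OF z _ unit2]
        unit_mod_shift[OF z, of a 0] unit by auto
  qed
  have 2: "unit_mod 3 (P_int g z 2)" using unit_z shift by (simp add: P_int_2[where g = g, OF g] unit_mod_mult)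
  \<comment> \<open>The condition on \<open>g 3\<close> gives \<open>e = e^2\<close>, so
    \<open>z^2 - g(3)\<close> splits modulo 3 as \<open>(z + e) * (z - e)\<close>. For residue 2 it
    would be \<open>z^2 + 1\<close>, irreducible modulo 3.\<close>
  define e t where "e = g 3 mod 3" and "t = g 3 div 3"
  hence e: "e = 0 \<or> e = 1" "g 3 = e + 3 * t" using g3 by (auto simp: cong_def)
  have "alg_cong 3 (P_int g z 3) (z * ((z + of_int e) * (z + of_int (- e))))"
  proof (rule alg_congI)
    show "algebraic_int (z * (of_int (g 2) * z + of_int (g 3)) - z * of_int t)"
      using alg_z by (auto intro!: algebraic_int_intros)
    show "P_int g z 3 = z * ((z + of_int e) * (z + of_int (- e))) +
        of_nat 3 * (z * (of_int (g 2) * z + of_int (g 3)) - z * of_int t)"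
      using e by (auto simp: P_int_3[where g = g, OF g] algebra_simps power2_eq_square)
  qed
  hence 3: "unit_mod 3 (P_int g z 3)"
    by (rule unit_mod_cong) (intro unit_mod_mult unit_z shift)
  show ?thesis
  proof (rule not_in_zero_set)
    show "algebraic_int z" by (fact alg_z)
    fix r :: nat assume "1 \<le> r" "r \<le> 3"
    hence "r = 1 \<or> r = 2 \<or> r = 3" by auto
    thus "unit_mod 3 (P_int g z r)"
      using unit_z 2 3 by (auto simp: P_int_1[where g = g, OF g, simplified])
  qed simp
qed

theorem theorem4:
  fixes g :: "nat \<Rightarrow> int" and m :: nat and \<zeta> :: complex
    and K O\<^sub>K :: "complex set"
  assumes "g 1 = 1"
    and "m \<ge> 3"
    and "primitive_root_of_unity m \<zeta>"
    and "K = rat_adjoin \<zeta>"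
    and "O\<^sub>K = ring_of_integers K"
  shows "((\<exists>p::nat. prime p \<and> p \<noteq> 2 \<and> p dvd m) \<longrightarrow>
            {\<zeta> + 2 * \<beta> | \<beta>. \<beta> \<in> O\<^sub>K} \<inter> zero_set g = {}) \<and>
         ((\<nexists>a l::nat. a \<in> {0, 1} \<and> m = 2 ^ a * 3 ^ l) \<and>
            ([g 3 = 0] (mod 3) \<or> [g 3 = 1] (mod 3)) \<longrightarrow>
            {\<zeta> + 3 * \<beta> | \<beta>. \<beta> \<in> O\<^sub>K} \<inter> zero_set g = {})"
proof -
  have "alg_cong 2 (\<zeta> + 2 * \<beta>) \<zeta>" "alg_cong 3 (\<zeta> + 3 * \<beta>) \<zeta>" if "\<beta> \<in> O\<^sub>K" for \<beta>
    using that assms(5) by (auto intro: alg_congI[of \<beta>] simp: ring_of_integers_def)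
  thus ?thesis
    using not_in_zero_set_2[where g = g, OF assms(1,3)]
      not_in_zero_set_3[where g = g, OF assms(1,3)] by blast
qed

end
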